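(* For every $m\in\mathbb{N}$, the Erdős–Hajnal conjecture holds for the family of all $\mathcal{H}_m$-free graphs, where $\mathcal{H}_m=\{H_m,H'_m,H''_m\}$. That is, for every $m\in\mathbb{N}$ there is a real constant $\delta=\delta(\mathcal{H}_m)>0$ such that every finite graph $G=(V,E)$ which is $\mathcal{H}_m$-free contains either a clique or an anti-clique of size at least $|V|^{\delta}$.
   Context: By a graph $G$ is meant, as usual, a pair $(V,E)$, where $E$ is a symmetric subset of $V\times V$. A clique in a graph is a set of vertices all pairwise adjacent; an anti-clique is a set of vertices such that any two different vertices from it are non-adjacent. A graph $G$ is $H$-free if it does not contain an induced subgraph isomorphic to $H$; for a finite set $\mathcal{H}$ of finite graphs, $G$ is $\mathcal{H}$-free if it omits all of the graphs $H\in\mathcal{H}$ simultaneously, i.e. it is $H$-free for every $H\in\mathcal{H}$. For $m\in\mathbb{N}$, the following three graphs each have the $2m$ vertices $a_1,\ldots,a_m,b_1,\ldots,b_m$ (pairs below denote undirected edges, indices range over $\{1,\ldots,m\}$): (1) $H_m$ (the half-graph on $2m$ vertices) has edges $\{(a_i,b_j): i<j\}$. (2) $H'_m$ (the complement graph of $H_m$) has edges $\{(a_i,b_j): i\geq j\}\cup\{(a_i,a_j): i\neq j\}\cup\{(b_i,b_j): i\neq j\}$. (3) $H''_m$ has edges $\{(a_i,b_j): i<j\}\cup\{(a_i,a_j): i\neq j\}$. *)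

theory Defs
  imports Complex_Main "Graph_Theory.Pair_Digraph" "Graph_Theory.Digraph_Isomorphism"
begin

text \<open>
  A finite graph \<open>(V, E)\<close> is a value of type \<open>'a pair_pre_digraph\<close> satisfying the locale predicate
  \<^const>\<open>pair_graph\<close>: \<open>V\<close> is finite and \<open>E\<close> is a symmetric, irreflexive subset of \<open>V \<times> V\<close>.
  Irreflexivity is needed: a reflexive graph cannot contain a loopless one on at
  least one vertex as an induced subgraph, and would be \<open>H\<close>-free for trivial reasons.
\<close>

definition clique :: "'a pair_pre_digraph \<Rightarrow> 'a set \<Rightarrow> bool" where
  "clique G S \<longleftrightarrow> S \<subseteq> pverts G \<and> (\<forall>u\<in>S. \<forall>v\<in>S. u \<noteq> v \<longrightarrow> (u, v) \<in> parcs G)"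

definition anti_clique :: "'a pair_pre_digraph \<Rightarrow> 'a set \<Rightarrow> bool" where
  "anti_clique G S \<longleftrightarrow> S \<subseteq> pverts G \<and> (\<forall>u\<in>S. \<forall>v\<in>S. u \<noteq> v \<longrightarrow> (u, v) \<notin> parcs G)"

definition graph_free :: "'b pair_pre_digraph \<Rightarrow> 'a pair_pre_digraph \<Rightarrow> bool" where
  "graph_free H G \<longleftrightarrow>
     \<not> (\<exists>K. induced_subgraph K (with_proj G) \<and> digraph_iso (with_proj H) K)"

definition family_free :: "'b pair_pre_digraph set \<Rightarrow> 'a pair_pre_digraph \<Rightarrow> bool" where
  "family_free \<H> G \<longleftrightarrow> (\<forall>H\<in>\<H>. graph_free H G)"

text \<open>The vertices \<open>a\<^sub>i\<close> and \<open>b\<^sub>i\<close> are \<open>Inl i\<close> and \<open>Inr i\<close>, for \<open>i \<in> {1..m}\<close>.\<close>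

definition ab_verts :: "nat \<Rightarrow> (nat + nat) set" where
  "ab_verts m = Inl ` {1..m} \<union> Inr ` {1..m}"

text \<open>The graph on \<open>V\<close> whose undirected edges are the pairs in \<open>R\<close>.\<close>

definition undirected :: "'a set \<Rightarrow> 'a rel \<Rightarrow> 'a pair_pre_digraph" where
  "undirected V R = \<lparr>pverts = V, parcs = R \<union> R\<inverse>\<rparr>"

definition half_graph :: "nat \<Rightarrow> (nat + nat) pair_pre_digraph" where
  "half_graph m = undirected (ab_verts m)
     {(Inl i, Inr j) | i j. i \<in> {1..m} \<and> j \<in> {1..m} \<and> i < j}"

definition half_graph' :: "nat \<Rightarrow> (nat + nat) pair_pre_digraph" where
  "half_graph' m = undirected (ab_verts m)
     ({(Inl i, Inr j) | i j. i \<in> {1..m} \<and> j \<in> {1..m} \<and> i \<ge> j}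
      \<union> {(Inl i, Inl j) | i j. i \<in> {1..m} \<and> j \<in> {1..m} \<and> i \<noteq> j}
      \<union> {(Inr i, Inr j) | i j. i \<in> {1..m} \<and> j \<in> {1..m} \<and> i \<noteq> j})"

definition half_graph'' :: "nat \<Rightarrow> (nat + nat) pair_pre_digraph" where
  "half_graph'' m = undirected (ab_verts m)
     ({(Inl i, Inr j) | i j. i \<in> {1..m} \<and> j \<in> {1..m} \<and> i < j}
      \<union> {(Inl i, Inl j) | i j. i \<in> {1..m} \<and> j \<in> {1..m} \<and> i \<noteq> j})"

definition half_graph_family :: "nat \<Rightarrow> (nat + nat) pair_pre_digraph set" where
  "half_graph_family m = {half_graph m, half_graph' m, half_graph'' m}"

lemma pair_graph_undirected:
  assumes "finite V" "R \<subseteq> V \<times> V" "irrefl R"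
  shows "pair_graph (undirected V R)"
proof -
  have "finite R"
    using assms(1,2) by (meson finite_SigmaI finite_subset)
  then show ?thesis
    using assms
    by unfold_locales
      (auto simp: undirected_def symmetric_def sym_def irrefl_def)
qed

lemma
  shows pair_graph_half_graph: "pair_graph (half_graph m)"
    and pair_graph_half_graph': "pair_graph (half_graph' m)"
    and pair_graph_half_graph'': "pair_graph (half_graph'' m)"
  unfolding half_graph_def half_graph'_def half_graph''_def
  by (rule pair_graph_undirected; auto simp: ab_verts_def irrefl_def)+

lemma half_graph'_complement:
  "parcs (half_graph' m) =
     {(u, v). u \<in> ab_verts m \<and> v \<in> ab_verts m \<and> u \<noteq> v \<and> (u, v) \<notin> parcs (half_graph m)}"
  by (auto simp: half_graph_def half_graph'_def undirected_def ab_verts_def)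

end

theory Submission
  imports Defs
begin

text \<open>
  Excluding the split half-graph \<open>H''\<^sub>m\<close> alone suffices. In the order
  \<open>b\<^sub>1, a\<^sub>1, b\<^sub>2, a\<^sub>2, \<dots>\<close> each \<open>b\<^sub>i\<close> is non-adjacent, and each \<open>a\<^sub>i\<close> adjacent, to all later vertices;
  so \<open>H''\<^sub>m\<close> is a threshold graph. By induction on the length of a word \<open>w\<close> of colours
  (adjacent or non-adjacent), a vertex set \<open>S\<close> of size \<open>N\<close> contains either vertices realising \<open>w\<close>
  in this sense or a homogeneous set of size \<open>N\<^sup>\<delta>\<close>: if some vertex has at least \<open>\<surd>N\<close> neighbours
  in \<open>S\<close> of the first colour of \<open>w\<close>, take it as the first vertex and continue among these
  neighbours; otherwise a greedy choice gives a set of about \<open>\<surd>N\<close> vertices that is homogeneous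
  in the other colour.
\<close>

text \<open>The condition \<open>x \<noteq> a\<close> matters for the colour \<open>False\<close>: a
  loopless graph would otherwise count \<open>a\<close> among its own non-neighbours, and a realised
  sequence could repeat a vertex.\<close>

definition colour_nbhd :: "'a rel \<Rightarrow> bool \<Rightarrow> 'a set \<Rightarrow> 'a \<Rightarrow> 'a set" where
  "colour_nbhd E c S a = {x \<in> S. x \<noteq> a \<and> ((a, x) \<in> E \<longleftrightarrow> c)}"

definition homogeneous :: "'a rel \<Rightarrow> bool \<Rightarrow> 'a set \<Rightarrow> bool" where
  "homogeneous E c T \<longleftrightarrow> (\<forall>u\<in>T. \<forall>v\<in>T. u \<noteq> v \<longrightarrow> ((u, v) \<in> E \<longleftrightarrow> c))"

text \<open>Restricting the candidates to the neighbourhood of each chosen vertex lets one letter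
  govern all pairs in which its vertex comes first. The last letter governs no pair and only asks
  for one more vertex.\<close>

fun realises :: "'a rel \<Rightarrow> 'a set \<Rightarrow> bool list \<Rightarrow> bool" where
  "realises E S [] \<longleftrightarrow> True"
| "realises E S (c # w) \<longleftrightarrow> (\<exists>a\<in>S. realises E (colour_nbhd E c S a) w)"

lemma realises_vertices:
  assumes "realises E S w"
  obtains f where "f ` {..<length w} \<subseteq> S" "inj_on f {..<length w}"
    "\<And>i j. i < j \<Longrightarrow> j < length w \<Longrightarrow> (f i, f j) \<in> E \<longleftrightarrow> w ! i"
  using assms
proof (induction w arbitrary: S thesis)
  case Nil
  then show ?case by simp
next
  case (Cons c w)
  from Cons.prems(2) obtain a where a: "a \<in> S" "realises E (colour_nbhd E c S a) w"
    by auto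
  obtain f where f: "f ` {..<length w} \<subseteq> colour_nbhd E c S a" "inj_on f {..<length w}"
    "\<And>i j. i < j \<Longrightarrow> j < length w \<Longrightarrow> (f i, f j) \<in> E \<longleftrightarrow> w ! i"
    using Cons.IH[OF _ a(2)] by blast
  let ?g = "case_nat a f"
  have nb: "f i \<in> S" "f i \<noteq> a" "(a, f i) \<in> E \<longleftrightarrow> c" if "i < length w" for i
    using f(1) that by (auto simp: colour_nbhd_def)
  show ?case
  proof (rule Cons.prems(1)[of ?g])
    show "?g ` {..<length (c # w)} \<subseteq> S"
      using nb(1) a(1) by (auto split: nat.splits)
    show "inj_on ?g {..<length (c # w)}"
      using f(2) nb(2) by (auto simp: inj_on_def split: nat.splits)
    show "(?g i, ?g j) \<in> E \<longleftrightarrow> (c # w) ! i" if "i < j" "j < length (c # w)" for i j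
      using that nb(3) f(3) by (cases i; cases j) auto
  qed
qed

text \<open>Choose a vertex and delete it together with its at most \<open>d\<close> neighbours of
  colour \<open>c\<close>. All survivors see it in the opposite colour, and each choice costs at
  most \<open>d + 1\<close> vertices.\<close>

lemma greedy_homogeneous:
  assumes "finite S" "sym E" "\<And>a. a \<in> S \<Longrightarrow> card (colour_nbhd E c S a) \<le> d"
  shows "\<exists>T\<subseteq>S. homogeneous E (\<not> c) T \<and> card S \<le> card T * (d + 1)"
  using assms(1,3)
proof (induction "card S" arbitrary: S rule: less_induct)
  case less
  show ?case
  proof (cases "S = {}")
    case True
    then show ?thesis by (auto simp: homogeneous_def)
  next
    case False
    then obtain a where a: "a \<in> S" by blast
    let ?B = "insert a (colour_nbhd E c S a)"
    let ?S' = "S - ?B"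
    have fin: "finite ?B" "finite ?S'"
      using less.prems(1) by (auto simp: colour_nbhd_def)
    have small: "card ?B \<le> d + 1"
      using less.prems(2)[OF a] fin(1)
      by (metis Suc_eq_plus1 Suc_le_mono card_insert_le_m1 card_insert_if finite_insert le_SucI)
    have deg: "card (colour_nbhd E c ?S' x) \<le> d" if "x \<in> ?S'" for x
    proof -
      have "card (colour_nbhd E c ?S' x) \<le> card (colour_nbhd E c S x)"
        using less.prems(1) by (intro card_mono) (auto simp: colour_nbhd_def)
      also have "\<dots> \<le> d" using less.prems(2) that by blast
      finally show ?thesis .
    qed
    have lt: "card ?S' < card S"
      using a less.prems(1) by (intro psubset_card_mono) auto
    obtain T where T: "T \<subseteq> ?S'" "homogeneous E (\<not> c) T"
      "card ?S' \<le> card T * (d + 1)"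
      using less.hyps[OF lt fin(2) deg] by blast
    have "finite T" using T(1) fin(2) finite_subset by blast
    moreover have "a \<notin> T" using T(1) by blast
    ultimately have "card (insert a T) = card T + 1" by simp
    moreover have "card S \<le> card ?S' + card ?B"
      using diff_card_le_card_Diff[OF fin(1), of S] by linarith
    ultimately have "card S \<le> card (insert a T) * (d + 1)"
      using T(3) small by simp
    moreover have "(a, x) \<in> E \<longleftrightarrow> \<not> c" "(x, a) \<in> E \<longleftrightarrow> \<not> c" if "x \<in> T" for x
      using T(1) that assms(2) by (auto simp: colour_nbhd_def dest: symD)
    then have "homogeneous E (\<not> c) (insert a T)"
      using T(2) by (auto simp: homogeneous_def)
    ultimately show ?thesis using T(1) a by blast
  qed
qed

text \<open>Serves the sets of 2 to 15 vertices, for which the required size is below 2.\<close>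

lemma homogeneous_subset_card_2:
  assumes "sym E" "2 \<le> card S"
  shows "\<exists>T c. T \<subseteq> S \<and> homogeneous E c T \<and> card T = 2"
proof -
  obtain T where T: "T \<subseteq> S" "card T = 2"
    using assms(2) obtain_subset_with_card_n by metis
  then obtain u v where "T = {u, v}" "u \<noteq> v"
    by (meson card_2_iff)
  then have "homogeneous E ((u, v) \<in> E) T"
    using assms(1) by (auto simp: homogeneous_def dest: symD)
  then show ?thesis using T by blast
qed

lemma homogeneous_of_not_realises:
  "\<exists>\<delta>>0. \<forall>E S. sym (E :: 'a rel) \<longrightarrow> finite S \<longrightarrow> \<not> realises E S w \<longrightarrow>
     (\<exists>T c. T \<subseteq> S \<and> homogeneous E c T \<and> real (card S) powr \<delta> \<le> real (card T))"
proof (induction w)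
  case Nil
  \<comment> \<open>The empty word is always realised, so the claim is vacuous for any
    exponent.\<close>
  show ?case by (intro exI[of _ 1]) simp
next
  case (Cons c w)
  then obtain \<delta> where \<delta>: "\<delta> > 0" and IH: "\<And>E S. sym (E :: 'a rel) \<Longrightarrow> finite S \<Longrightarrow>
      \<not> realises E S w \<Longrightarrow>
      \<exists>T c. T \<subseteq> S \<and> homogeneous E c T \<and> real (card S) powr \<delta> \<le> real (card T)"
    by blast
  \<comment> \<open>Passing to a neighbourhood of size at least \<open>sqrt N\<close> halves the
    exponent, whence \<open>\<delta>/2\<close>. The greedy set has size at least
    \<open>sqrt N / 2\<close>, which is at least \<open>N powr (1/4)\<close> once \<open>N\<close>
    is at least 16.\<close>
  define \<epsilon> where "\<epsilon> = min (1/4) (\<delta>/2)"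
  have \<epsilon>: "\<epsilon> > 0" "\<epsilon> \<le> 1/4" "\<epsilon> \<le> \<delta>/2"
    using \<delta> by (auto simp: \<epsilon>_def)
  have "\<exists>T c. T \<subseteq> S \<and> homogeneous E c T \<and> real (card S) powr \<epsilon> \<le> real (card T)"
    if E: "sym (E :: 'a rel)" and S: "finite S" and nr: "\<not> realises E S (c # w)" for E S
  proof -
    define N where "N = real (card S)"
    consider "card S = 0" | "card S = 1" | "2 \<le> card S" "card S < 16" | "16 \<le> card S"
      by linarith
    then show ?thesis
    proof cases
      case 1
      then show ?thesis
        by (intro exI[of _ "{}"]) (auto simp: homogeneous_def)
    next
      case 2
      then obtain a where "S = {a}" by (meson card_1_singletonE)
      then show ?thesis
        by (intro exI[of _ S]) (auto simp: homogeneous_def)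
    next
      case 3
      have "N powr \<epsilon> \<le> N powr (1/4)"
        using 3 \<epsilon> by (intro powr_mono) (auto simp: N_def)
      also have "\<dots> \<le> 16 powr (1/4)"
        using 3 by (intro powr_mono2) (auto simp: N_def)
      also have "16 powr (1/4) = (2 powr 4) powr (1/4 :: real)" by simp
      also have "\<dots> = 2" by (subst powr_powr) simp
      finally show ?thesis
        using homogeneous_subset_card_2[OF E 3(1)] by (metis N_def of_nat_numeral)
    next
      case 4
      have N: "N \<ge> 16" using 4 by (simp add: N_def)
      show ?thesis
      proof (cases "\<exists>a\<in>S. sqrt N \<le> real (card (colour_nbhd E c S a))")
        case True
        then obtain a where a: "a \<in> S" "sqrt N \<le> real (card (colour_nbhd E c S a))"
          by blast
        let ?B = "colour_nbhd E c S a"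
        have "finite ?B" "\<not> realises E ?B w"
          using S nr a(1) by (auto simp: colour_nbhd_def)
        from IH[OF E this] obtain T c' where T: "T \<subseteq> ?B" "homogeneous E c' T"
          "real (card ?B) powr \<delta> \<le> real (card T)" by blast
        have "N powr \<epsilon> \<le> N powr (\<delta>/2)"
          using N \<epsilon>(3) by (intro powr_mono) auto
        also have "\<dots> = sqrt N powr \<delta>"
          using N by (simp add: powr_half_sqrt[symmetric] powr_powr)
        also have "\<dots> \<le> real (card ?B) powr \<delta>"
          using a(2) \<delta> N by (intro powr_mono2) auto
        also note T(3)
        finally show ?thesis
          using T(1,2) by (auto simp: N_def colour_nbhd_def)
      next
        case False
        let ?d = "nat \<lfloor>sqrt N\<rfloor>"
        have "card (colour_nbhd E c S a) \<le> ?d" if "a \<in> S" for a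
          using False that by (force simp: le_nat_floor)
        from greedy_homogeneous[OF S E this] obtain T where T: "T \<subseteq> S"
          "homogeneous E (\<not> c) T" "card S \<le> card T * (?d + 1)" by blast
        \<comment> \<open>With the fourth root \<open>r\<close> the estimate becomes polynomial:
          \<open>r^4\<close> is at most \<open>card T * (r^2 + 1)\<close>, hence at most
          \<open>2 * r^2 * card T\<close>. So \<open>card T\<close> is at least
          \<open>r^2 / 2\<close>, and this is at least \<open>r\<close> because \<open>r\<close> is
          at least 2.\<close>
        define r where "r = N powr (1/4)"
        have r2: "sqrt N = r * r"
          using N by (simp add: r_def powr_half_sqrt[symmetric] powr_add[symmetric])
        have "(2 powr 4) powr (1/4 :: real) \<le> r"
          unfolding r_def using N by (intro powr_mono2) auto
        then have r: "2 \<le> r" by (subst (asm) powr_powr) simp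
        have r4: "N = (r * r) * (r * r)"
          using N r2 by (metis real_sqrt_mult_self abs_of_nonneg order_trans zero_le_numeral)
        have "N \<le> real (card T) * (real ?d + 1)"
          using T(3) unfolding N_def by (metis of_nat_1 of_nat_add of_nat_le_iff of_nat_mult)
        also have "\<dots> \<le> real (card T) * (r * r + 1)"
          using N r2[symmetric] by (intro mult_left_mono) auto
        also have "\<dots> \<le> real (card T) * (2 * (r * r))"
          using mult_mono[OF r r] r by (intro mult_left_mono) auto
        finally have "(r * r) * (r * r) \<le> (2 * real (card T)) * (r * r)"
          using r4 by (simp add: mult_ac)
        then have "r * r \<le> 2 * real (card T)"
          using r by (simp add: mult_le_cancel_right)
        moreover have "2 * r \<le> r * r" using r by simp
        ultimately have "r \<le> real (card T)" by linarith
        moreover have "N powr \<epsilon> \<le> r"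
          unfolding r_def using N \<epsilon> by (intro powr_mono) auto
        ultimately show ?thesis using T(1,2) by (auto simp: N_def)
      qed
    qed
  qed
  then show ?case using \<epsilon>(1) by blast
qed

text \<open>The image of \<open>H\<close> under \<open>g\<close> is isomorphic to \<open>H\<close>
  by construction. It is an induced subgraph because \<open>adj\<close> is an equivalence:
  \<open>G\<close> has no further arcs among the image vertices.\<close>

lemma not_graph_free_if_embedding:
  assumes H: "pair_graph H" and G: "pair_graph G"
    and g: "inj_on g (pverts H)" "g ` pverts H \<subseteq> pverts G"
    and adj: "\<And>u v. u \<in> pverts H \<Longrightarrow> v \<in> pverts H \<Longrightarrow> (g u, g v) \<in> parcs G \<longleftrightarrow> (u, v) \<in> parcs H"
  shows "\<not> graph_free H G"
proof -
  interpret H: pair_graph H by fact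
  interpret G: pair_graph G by fact
  \<comment> \<open>Arcs are vertex pairs, so they are moved by \<open>map_prod g g\<close>; keeping
    \<open>fst\<close> and \<open>snd\<close> as tail and head makes the image compatible with
    \<open>with_proj G\<close>.\<close>
  let ?f = "\<lparr>iso_verts = g, iso_arcs = map_prod g g, iso_head = snd, iso_tail = fst\<rparr>"
  let ?K = "app_iso ?f (with_proj H)"
  have "inj_on (map_prod g g) (parcs H)"
    using map_prod_inj_on[OF g(1) g(1)] by (rule inj_on_subset) (auto dest: H.wellformed')
  then have "digraph_iso (with_proj H) ?K"
    using g(1) H.wf_digraph unfolding digraph_iso_def H.digraph_isomorphism_def
    by (intro exI[of _ ?f] conjI[OF _ refl]) simp
  moreover have K_arcs: "arcs ?K = {e \<in> parcs G. fst e \<in> g ` pverts H \<and> snd e \<in> g ` pverts H}"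
  proof (intro equalityI subsetI)
    fix e assume "e \<in> arcs ?K"
    then obtain u v where "(u, v) \<in> parcs H" "e = (g u, g v)" by auto
    then show "e \<in> {e \<in> parcs G. fst e \<in> g ` pverts H \<and> snd e \<in> g ` pverts H}"
      using adj H.wellformed'[of u v] by simp
  next
    fix e assume "e \<in> {e \<in> parcs G. fst e \<in> g ` pverts H \<and> snd e \<in> g ` pverts H}"
    then obtain u v where "u \<in> pverts H" "v \<in> pverts H" "e = (g u, g v)" "e \<in> parcs G"
      by (cases e) auto
    then have "(u, v) \<in> parcs H" "e = map_prod g g (u, v)" using adj by auto
    then have "e \<in> map_prod g g ` parcs H" by (metis image_eqI)
    then show "e \<in> arcs ?K" by simp
  qed
  have "wf_digraph ?K"
    by (unfold_locales; unfold K_arcs; simp)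
  then have "induced_subgraph ?K (with_proj G)"
    using K_arcs g(2) G.wf_digraph
    by (auto simp: induced_subgraph_def subgraph_def compatible_def)
  ultimately show ?thesis unfolding graph_free_def by blast
qed

lemma not_graph_free_half_graph''_if_realises:
  assumes G: "pair_graph G" and real: "realises (parcs G) (pverts G) (map odd [0..<2 * m])"
  shows "\<not> graph_free (half_graph'' m) G"
proof -
  interpret G: pair_graph G by fact
  obtain f where f: "f ` {..<2 * m} \<subseteq> pverts G" "inj_on f {..<2 * m}"
    and less: "\<And>i j. i < j \<Longrightarrow> j < 2 * m \<Longrightarrow> (f i, f j) \<in> parcs G \<longleftrightarrow> odd i"
    using realises_vertices[OF real] by (auto simp del: upt_Suc)
  have greater: "(f i, f j) \<in> parcs G \<longleftrightarrow> odd j" if "j < i" "i < 2 * m" for i j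
    using less[OF that] G.pair_sym_arcs by (auto simp: symmetric_def dest: symD)
  have loop: "(x, x) \<notin> parcs G" for x
    using G.pair_no_loops by fastforce
  \<comment> \<open>Positions count from 0: \<open>Inr i\<close> sits at the even place
    \<open>2 * i - 2\<close> and \<open>Inl i\<close> directly after it. Of two distinct vertices
    the earlier decides adjacency, so \<open>Inl i\<close> and \<open>Inr j\<close> are adjacent iff
    \<open>2 * i - 1 < 2 * j - 2\<close>, that is, iff \<open>i < j\<close>. The subtractions do not
    truncate, as indices start at 1.\<close>
  define p :: "nat + nat \<Rightarrow> nat" where "p = case_sum (\<lambda>i. 2 * i - 1) (\<lambda>i. 2 * i - 2)"
  have p_inj: "inj_on p (ab_verts m)"
    by (auto simp: inj_on_def p_def ab_verts_def; presburger)
  have p_less: "p ` ab_verts m \<subseteq> {..<2 * m}"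
    by (auto simp: p_def ab_verts_def)
  have adj: "(f i, f j) \<in> parcs G \<longleftrightarrow> i \<noteq> j \<and> odd (min i j)" if "i < 2 * m" "j < 2 * m" for i j
    using that less greater loop by (cases i j rule: linorder_cases) (auto simp: min_def)
  show ?thesis
  proof (rule not_graph_free_if_embedding[OF pair_graph_half_graph'' G])
    have verts: "pverts (half_graph'' m) = ab_verts m"
      by (simp add: half_graph''_def undirected_def)
    show "inj_on (f \<circ> p) (pverts (half_graph'' m))"
      unfolding verts using p_inj p_less f(2) by (meson comp_inj_on inj_on_subset)
    show "(f \<circ> p) ` pverts (half_graph'' m) \<subseteq> pverts G"
      unfolding verts using p_less f(1) by auto
    fix u v assume "u \<in> pverts (half_graph'' m)" "v \<in> pverts (half_graph'' m)"
    then have uv: "u \<in> ab_verts m" "v \<in> ab_verts m" by (simp_all add: verts)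
    then have "p u < 2 * m" "p v < 2 * m" using p_less by auto
    then have "((f \<circ> p) u, (f \<circ> p) v) \<in> parcs G \<longleftrightarrow> p u \<noteq> p v \<and> odd (min (p u) (p v))"
      by (simp add: adj)
    also have "\<dots> \<longleftrightarrow> (u, v) \<in> parcs (half_graph'' m)"
      using uv
      by (auto simp: ab_verts_def p_def half_graph''_def undirected_def min_def)
    finally show "((f \<circ> p) u, (f \<circ> p) v) \<in> parcs G \<longleftrightarrow> (u, v) \<in> parcs (half_graph'' m)" .
  qed
qed

theorem corollary1p5:
  fixes m :: nat
  shows "\<exists>\<delta>::real. \<delta> > 0 \<and>
    (\<forall>G :: 'a pair_pre_digraph. pair_graph G \<and> family_free (half_graph_family m) G \<longrightarrow>
      (\<exists>S. (clique G S \<or> anti_clique G S) \<and>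
           real (card S) \<ge> real (card (pverts G)) powr \<delta>))"
proof -
  \<comment> \<open>The word depends on \<open>m\<close> alone, so the exponent is fixed before the
    graph is.\<close>
  obtain \<delta> where \<delta>: "\<delta> > 0" and hom: "\<And>E S. sym (E :: 'a rel) \<Longrightarrow> finite S \<Longrightarrow>
      \<not> realises E S (map odd [0..<2 * m]) \<Longrightarrow>
      \<exists>T c. T \<subseteq> S \<and> homogeneous E c T \<and> real (card S) powr \<delta> \<le> real (card T)"
    using homogeneous_of_not_realises[of "map odd [0..<2 * m]"] by blast
  have "\<exists>S. (clique G S \<or> anti_clique G S) \<and> real (card S) \<ge> real (card (pverts G)) powr \<delta>"
    if G: "pair_graph G" and free: "family_free (half_graph_family m) G"
    for G :: "'a pair_pre_digraph"
  proof -
    interpret G: pair_graph G by fact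
    have "graph_free (half_graph'' m) G"
      using free by (simp add: family_free_def half_graph_family_def)
    then have "\<not> realises (parcs G) (pverts G) (map odd [0..<2 * m])"
      using not_graph_free_half_graph''_if_realises[OF G] by blast
    moreover have "sym (parcs G)"
      using G.pair_sym_arcs by (simp add: symmetric_def)
    ultimately obtain T c where T: "T \<subseteq> pverts G" "homogeneous (parcs G) c T"
      "real (card (pverts G)) powr \<delta> \<le> real (card T)"
      using hom G.pair_finite_verts by blast
    have "clique G T \<or> anti_clique G T"
      using T(1,2) by (cases c) (auto simp: clique_def anti_clique_def homogeneous_def)
    then show ?thesis using T(3) by blast
  qed
  then show ?thesis using \<delta> by blast
qed

end
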